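(* The real-linear map $\tau:\mathbb{O}\to\mathbb{O}$ given by $$\tau(1)=1,\quad \tau(e_3)=e_3,\quad \tau(e_1)=e_2,\quad \tau(e_2)=-e_4,\quad \tau(e_4)=-e_1,\quad \tau(e_5)=-e_7,\quad \tau(e_7)=e_6,\quad \tau(e_6)=-e_5$$ is an automorphism of order three of the real octonion algebra $(\mathbb{O},\cdot)$, and the real algebra $(\mathbb{O},* )$ with product $$x*y=\tau(\overline{x})\cdot\tau^{2}(\overline{y})$$ (the Petersson isotope of $\mathbb{O}$ by $\tau$) is isomorphic to the compact real Okubo algebra $\mathcal{O}$.
   Context: Octonions: $\mathbb{O}$ is the real algebra with basis $e_0=1,e_1,\dots,e_7$, where $1$ is the unit, $e_k^2=-1$ for $k\ge 1$, $e_ie_j=-e_je_i$ for distinct $i,j\geq 1$, and $e_ie_j=e_k$ whenever $(i,j,k)$ is a cyclic permutation of one of the seven oriented triples $(1,2,4),(1,3,7),(2,3,6),(4,3,5),(6,1,5),(5,2,7),(7,4,6)$. Conjugation is $\overline{x_0+\sum_{k\ge1} x_ke_k}=x_0-\sum_{k\ge1} x_ke_k$. Compact real Okubo algebra: $\mathcal{O}$ is the 8-dimensional real vector space of traceless Hermitian $3\times3$ complex matrices with the bilinear product $$x*y=\mu\, xy+\overline{\mu}\, yx-\tfrac13\operatorname{Tr}(xy)I_3,\qquad \mu=\tfrac16(3+\mathrm{i}\sqrt3),$$ where juxtaposition is the matrix product; its norm is $n(x)=\tfrac16\operatorname{Tr}(x^2)$, which is positive definite. *)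

theory Defs
  imports "HOL-Analysis.Analysis"
begin

section \<open>Real algebras and their isomorphisms\<close>

text \<open>
  A real algebra (no associativity, commutativity or unit is required) is given by a
  carrier inside an ambient real vector space and a product.
\<close>

definition real_algebra_on :: "'a::real_vector set \<Rightarrow> ('a \<Rightarrow> 'a \<Rightarrow> 'a) \<Rightarrow> bool" where
  "real_algebra_on S m \<longleftrightarrow>
     subspace S \<and>
     (\<forall>x\<in>S. \<forall>y\<in>S. m x y \<in> S) \<and>
     (\<forall>x\<in>S. \<forall>y\<in>S. \<forall>z\<in>S. m (x + y) z = m x z + m y z \<and> m x (y + z) = m x y + m x z) \<and>
     (\<forall>c. \<forall>x\<in>S. \<forall>y\<in>S. m (c *\<^sub>R x) y = c *\<^sub>R m x y \<and> m x (c *\<^sub>R y) = c *\<^sub>R m x y)"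

definition real_algebra_iso ::
  "'a::real_vector set \<Rightarrow> ('a \<Rightarrow> 'a \<Rightarrow> 'a) \<Rightarrow> 'b::real_vector set \<Rightarrow> ('b \<Rightarrow> 'b \<Rightarrow> 'b) \<Rightarrow> ('a \<Rightarrow> 'b) \<Rightarrow> bool"
where
  "real_algebra_iso S m T m' f \<longleftrightarrow>
     bij_betw f S T \<and>
     (\<forall>x\<in>S. \<forall>y\<in>S. f (x + y) = f x + f y) \<and>
     (\<forall>c. \<forall>x\<in>S. f (c *\<^sub>R x) = c *\<^sub>R f x) \<and>
     (\<forall>x\<in>S. \<forall>y\<in>S. f (m x y) = m' (f x) (f y))"

definition real_algebra_isomorphic ::
  "'a::real_vector set \<Rightarrow> ('a \<Rightarrow> 'a \<Rightarrow> 'a) \<Rightarrow> 'b::real_vector set \<Rightarrow> ('b \<Rightarrow> 'b \<Rightarrow> 'b) \<Rightarrow> bool"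
where
  "real_algebra_isomorphic S m T m' \<longleftrightarrow> (\<exists>f. real_algebra_iso S m T m' f)"

definition real_algebra_automorphism ::
  "'a::real_vector set \<Rightarrow> ('a \<Rightarrow> 'a \<Rightarrow> 'a) \<Rightarrow> ('a \<Rightarrow> 'a) \<Rightarrow> bool"
where
  "real_algebra_automorphism S m f \<longleftrightarrow> real_algebra_iso S m S m f"

definition map_has_order :: "('a \<Rightarrow> 'a) \<Rightarrow> nat \<Rightarrow> bool" where
  "map_has_order f n \<longleftrightarrow> 0 < n \<and> f ^^ n = id \<and> (\<forall>k. 0 < k \<and> k < n \<longrightarrow> f ^^ k \<noteq> id)"


section \<open>Octonions\<close>

text \<open>
  The index type \<open>8\<close> consists of the residues modulo 8, so its elements are
  \<open>0, 1, \<dots>, 7\<close> and the coordinates of an octonion are numbered from 0.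
\<close>

type_synonym octonion = "real ^ 8"

abbreviation oct_e :: "8 \<Rightarrow> octonion" where
  "oct_e k \<equiv> axis k 1"

definition oct_triples :: "(8 \<times> 8 \<times> 8) set" where
  "oct_triples = {(1,2,4), (1,3,7), (2,3,6), (4,3,5), (6,1,5), (5,2,7), (7,4,6)}"

definition oct_cyclic :: "8 \<Rightarrow> 8 \<Rightarrow> 8 \<Rightarrow> bool" where
  "oct_cyclic i j k \<longleftrightarrow>
     (i,j,k) \<in> oct_triples \<or> (j,k,i) \<in> oct_triples \<or> (k,i,j) \<in> oct_triples"

text \<open>\<open>oct_coeff i j k\<close> is the coefficient of \<open>e\<^sub>k\<close> in \<open>e\<^sub>i e\<^sub>j\<close>.\<close>

definition oct_coeff :: "8 \<Rightarrow> 8 \<Rightarrow> 8 \<Rightarrow> real" where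
  "oct_coeff i j k =
     (if i = 0 then (if k = j then 1 else 0)
      else if j = 0 then (if k = i then 1 else 0)
      else if i = j then (if k = 0 then - 1 else 0)
      else if oct_cyclic i j k then 1
      else if oct_cyclic j i k then - 1
      else 0)"

definition oct_mult :: "octonion \<Rightarrow> octonion \<Rightarrow> octonion" where
  "oct_mult x y = (\<chi> k. \<Sum>i\<in>UNIV. \<Sum>j\<in>UNIV. x $ i * y $ j * oct_coeff i j k)"

definition oct_cnj :: "octonion \<Rightarrow> octonion" where
  "oct_cnj x = (\<chi> k. if k = 0 then x $ 0 else - (x $ k))"

definition oct_tau :: "octonion \<Rightarrow> octonion" where
  "oct_tau x =
     x $ 0 *\<^sub>R oct_e 0 + x $ 3 *\<^sub>R oct_e 3 +
     x $ 1 *\<^sub>R oct_e 2 + x $ 2 *\<^sub>R (- oct_e 4) + x $ 4 *\<^sub>R (- oct_e 1) +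
     x $ 5 *\<^sub>R (- oct_e 7) + x $ 7 *\<^sub>R oct_e 6 + x $ 6 *\<^sub>R (- oct_e 5)"

definition petersson_mult :: "(octonion \<Rightarrow> octonion) \<Rightarrow> octonion \<Rightarrow> octonion \<Rightarrow> octonion" where
  "petersson_mult \<tau> x y = oct_mult (\<tau> (oct_cnj x)) ((\<tau> ^^ 2) (oct_cnj y))"

lemma bilinear_oct_mult: "bilinear oct_mult"
  unfolding bilinear_def
  by (intro conjI allI linearI)
    (simp_all add: oct_mult_def vec_eq_iff algebra_simps sum.distrib sum_distrib_left)

lemma linear_oct_cnj: "linear oct_cnj"
  by (rule linearI) (simp_all add: oct_cnj_def vec_eq_iff)

lemma linear_oct_tau: "linear oct_tau"
  by (rule linearI) (simp_all add: oct_tau_def algebra_simps)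

lemma oct_tau_basis:
  "oct_tau (oct_e 0) = oct_e 0" "oct_tau (oct_e 3) = oct_e 3"
  "oct_tau (oct_e 1) = oct_e 2" "oct_tau (oct_e 2) = - oct_e 4" "oct_tau (oct_e 4) = - oct_e 1"
  "oct_tau (oct_e 5) = - oct_e 7" "oct_tau (oct_e 7) = oct_e 6" "oct_tau (oct_e 6) = - oct_e 5"
  by (simp_all add: oct_tau_def axis_def)

lemma oct_mult_e: "oct_mult (oct_e i) (oct_e j) = (\<chi> k. oct_coeff i j k)"
proof -
  have "(\<Sum>a\<in>UNIV. \<Sum>b\<in>UNIV. oct_e i $ a * oct_e j $ b * oct_coeff a b k) = oct_coeff i j k" for k
  proof -
    have "oct_e i $ a * oct_e j $ b * oct_coeff a b k
        = (if b = j then if a = i then oct_coeff i j k else 0 else 0)" for a b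
      by (simp add: axis_def)
    then show ?thesis by simp
  qed
  then show ?thesis by (simp add: oct_mult_def vec_eq_iff)
qed

lemma oct_mult_unit: "oct_mult (oct_e 0) (oct_e i) = oct_e i" "oct_mult (oct_e i) (oct_e 0) = oct_e i"
  unfolding oct_mult_e by (auto simp: oct_coeff_def axis_def vec_eq_iff)

lemma oct_mult_square: "i \<noteq> 0 \<Longrightarrow> oct_mult (oct_e i) (oct_e i) = - oct_e 0"
  unfolding oct_mult_e by (auto simp: oct_coeff_def axis_def vec_eq_iff)

lemma oct_cyclic_unique:
  assumes "oct_cyclic i j k"
  shows "i \<noteq> 0 \<and> j \<noteq> 0 \<and> i \<noteq> j \<and> (\<forall>l. (oct_cyclic i j l \<longleftrightarrow> l = k) \<and> \<not> oct_cyclic j i l)"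
  using assms
  unfolding oct_cyclic_def oct_triples_def insert_iff empty_iff prod.inject simp_thms
  by (elim disjE conjE) (hypsubst, simp)+

lemma oct_mult_cyclic:
  assumes "oct_cyclic i j k"
  shows "oct_mult (oct_e i) (oct_e j) = oct_e k" "oct_mult (oct_e j) (oct_e i) = - oct_e k"
  unfolding oct_mult_e
  using oct_cyclic_unique[OF assms] by (auto simp: oct_coeff_def axis_def vec_eq_iff)

lemma real_algebra_petersson:
  assumes "linear \<tau>"
  shows "real_algebra_on UNIV (petersson_mult \<tau>)"
proof -
  have t2: "linear (\<tau> ^^ 2)"
    using linear_compose[OF assms assms] by (simp add: numeral_2_eq_2)
  show ?thesis
    unfolding real_algebra_on_def petersson_mult_def
    by (simp add: linear_add[OF linear_oct_cnj] linear_add[OF assms] linear_add[OF t2]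
        linear_scale[OF linear_oct_cnj] linear_scale[OF assms] linear_scale[OF t2]
        bilinear_ladd[OF bilinear_oct_mult] bilinear_radd[OF bilinear_oct_mult]
        bilinear_lmul[OF bilinear_oct_mult] bilinear_rmul[OF bilinear_oct_mult]
        del: funpow.simps)
qed


section \<open>The compact real Okubo algebra\<close>

definition hermitian_matrix :: "complex ^ 'n ^ 'n \<Rightarrow> bool" where
  "hermitian_matrix A \<longleftrightarrow> (\<chi> i j. cnj (A $ j $ i)) = A"

definition okubo_carrier :: "(complex ^ 3 ^ 3) set" where
  "okubo_carrier = {A. hermitian_matrix A \<and> trace A = 0}"

definition cmat_scale :: "complex \<Rightarrow> complex ^ 'n ^ 'm \<Rightarrow> complex ^ 'n ^ 'm" where
  "cmat_scale c A = (\<chi> i j. c * A $ i $ j)"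

definition okubo_mu :: complex where
  "okubo_mu = (1 / 6) * (3 + \<i> * complex_of_real (sqrt 3))"

definition okubo_mult :: "complex ^ 3 ^ 3 \<Rightarrow> complex ^ 3 ^ 3 \<Rightarrow> complex ^ 3 ^ 3" where
  "okubo_mult x y =
     cmat_scale okubo_mu (x ** y) + cmat_scale (cnj okubo_mu) (y ** x)
     - cmat_scale (1 / 3 * trace (x ** y)) (mat 1)"

lemma real_algebra_okubo: "real_algebra_on okubo_carrier okubo_mult"
proof -
  have sub: "subspace okubo_carrier"
    by (auto simp: subspace_def okubo_carrier_def hermitian_matrix_def trace_def vec_eq_iff
        sum.distrib scaleR_right.sum[symmetric])
  have closed: "okubo_mult x y \<in> okubo_carrier" if "x \<in> okubo_carrier" "y \<in> okubo_carrier" for x y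
  proof -
    have hx: "cnj (x $ j $ i) = x $ i $ j" and hy: "cnj (y $ j $ i) = y $ i $ j" for i j
      using that by (auto simp: okubo_carrier_def hermitian_matrix_def vec_eq_iff)
    have h1: "cnj ((x ** y) $ j $ i) = (y ** x) $ i $ j" and h2: "cnj ((y ** x) $ j $ i) = (x ** y) $ i $ j" for i j
      by (simp_all add: matrix_matrix_mult_def hx hy mult.commute)
    have tc: "trace (y ** x) = trace (x ** y)"
      by (rule trace_mul_sym)
    have tr: "cnj (trace (x ** y)) = trace (x ** y)"
      using tc by (simp add: trace_def h1)
    have mu: "okubo_mu + cnj okubo_mu = 1"
      by (simp add: okubo_mu_def complex_eq_iff)
    have "hermitian_matrix (okubo_mult x y)"
      by (auto simp: hermitian_matrix_def okubo_mult_def cmat_scale_def vec_eq_iff h1 h2 tr mat_def)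
    moreover have "trace (okubo_mult x y) = (okubo_mu + cnj okubo_mu) * trace (x ** y) - trace (x ** y)"
    proof -
      have s: "trace (cmat_scale c A) = c * trace A" for c and A :: "complex^3^3"
        by (simp add: trace_def cmat_scale_def sum_distrib_left)
      show ?thesis
        by (simp add: okubo_mult_def trace_add trace_sub s trace_I tc algebra_simps)
    qed
    ultimately show ?thesis by (simp add: okubo_carrier_def mu)
  qed
  have ml: "(c *\<^sub>R x) ** y = c *\<^sub>R (x ** y)" and mr: "x ** (c *\<^sub>R y) = c *\<^sub>R (x ** y)"
    for c and x y :: "complex^3^3"
    by (simp_all add: matrix_matrix_mult_def vec_eq_iff scaleR_right.sum)
  have ts: "trace (c *\<^sub>R x) = c *\<^sub>R trace x" for c and x :: "complex^3^3"
    by (simp add: trace_def scaleR_right.sum)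
  have ma: "(x + y) ** z = x ** z + y ** z" for x y z :: "complex^3^3"
    by (simp add: matrix_matrix_mult_def vec_eq_iff algebra_simps sum.distrib)
  have ca: "cmat_scale a (x + y) = cmat_scale a x + cmat_scale a y"
    and cs: "cmat_scale a (c *\<^sub>R x) = c *\<^sub>R cmat_scale a x"
    and ca': "cmat_scale (1 / 3 * (a + b)) x = cmat_scale (1 / 3 * a) x + cmat_scale (1 / 3 * b) x"
    and cs': "cmat_scale (1 / 3 * (c *\<^sub>R a)) x = c *\<^sub>R cmat_scale (1 / 3 * a) x"
    for a b c and x y :: "complex^3^3"
    by (simp_all add: cmat_scale_def vec_eq_iff algebra_simps add_divide_distrib)
  show ?thesis
    unfolding real_algebra_on_def okubo_mult_def
    using sub closed[unfolded okubo_mult_def]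
    by (simp only: ml mr ma matrix_add_ldistrib ts trace_add ca cs ca' cs')
      (simp add: algebra_simps)
qed

end

theory Submission
  imports Defs
begin

text \<open>
  The unit of the octonions is an idempotent of the Petersson isotope, so it must correspond to
  an idempotent of the Okubo algebra; these are the conjugates of \<open>e = diag(-1, -1, 2)\<close>.
  For \<open>g x = (2n(e,x)e - x) * e\<close> and \<open>x \<cdot> y = (e * x) * (y * e)\<close> the Okubo algebra becomes
  the octonions with an automorphism \<open>g\<close> of order three that fixes the commutant of \<open>e\<close>, a
  quaternion algebra. Hence \<open>e\<^sub>3\<close>, which \<open>\<tau>\<close> fixes, may be sent to \<open>diag(\<surd>3, -\<surd>3, 0)\<close>,
  \<open>e\<^sub>1\<close> to the matrix with rows \<open>(0, 1, 1)\<close>, \<open>(1, 0, -1)\<close>, \<open>(1, -1, 0)\<close>, and the images of the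
  other basis elements are then forced, since \<open>e\<^sub>1\<close> and \<open>e\<^sub>3\<close> generate the octonions under
  \<open>\<tau>\<close> and multiplication. That the resulting linear map is multiplicative is checked on the
  basis.
\<close>

lemma UNIV_8: "(UNIV :: 8 set) = {0, 1, 2, 3, 4, 5, 6, 7}"
  by (rule sym, rule card_eq_UNIV_imp_eq_UNIV) simp_all

lemma forall_8: "(\<forall>k::8. P k) \<longleftrightarrow> P 0 \<and> P 1 \<and> P 2 \<and> P 3 \<and> P 4 \<and> P 5 \<and> P 6 \<and> P 7"
proof -
  have "(\<forall>k::8. P k) \<longleftrightarrow> (\<forall>k\<in>UNIV. P k)" by simp
  then show ?thesis unfolding UNIV_8 by simp
qed

lemma axis_nth_if: "axis k a $ i = (if i = k then a else 0)"
  by (simp add: axis_def)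

text \<open>Right-nested products, as left by \<open>field_simps\<close>, hide the factor
  \<open>sqrt 3 * sqrt 3\<close>; this collapses it.\<close>

lemma sqrt_3_mult: "sqrt 3 * (sqrt 3 * x) = 3 * x"
  by (simp flip: mult.assoc)

text \<open>The premise is a concrete membership, so each instance simplifies to six unconditional
  rewrite rules. Seven triples yield all 42 products of distinct imaginary units.\<close>

lemma oct_mult_table:
  assumes "(i, j, k) \<in> oct_triples"
  shows "oct_mult (oct_e i) (oct_e j) = oct_e k" "oct_mult (oct_e j) (oct_e i) = - oct_e k"
    "oct_mult (oct_e j) (oct_e k) = oct_e i" "oct_mult (oct_e k) (oct_e j) = - oct_e i"
    "oct_mult (oct_e k) (oct_e i) = oct_e j" "oct_mult (oct_e i) (oct_e k) = - oct_e j"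
proof -
  have "oct_cyclic i j k" "oct_cyclic j k i" "oct_cyclic k i j"
    using assms by (auto simp: oct_cyclic_def)
  then show "oct_mult (oct_e i) (oct_e j) = oct_e k" "oct_mult (oct_e j) (oct_e i) = - oct_e k"
    "oct_mult (oct_e j) (oct_e k) = oct_e i" "oct_mult (oct_e k) (oct_e j) = - oct_e i"
    "oct_mult (oct_e k) (oct_e i) = oct_e j" "oct_mult (oct_e i) (oct_e k) = - oct_e j"
    by (auto dest: oct_mult_cyclic)
qed

lemmas oct_mult_basis =
  oct_mult_table[of 1 2 4, unfolded oct_triples_def, simplified]
  oct_mult_table[of 1 3 7, unfolded oct_triples_def, simplified]
  oct_mult_table[of 2 3 6, unfolded oct_triples_def, simplified]
  oct_mult_table[of 4 3 5, unfolded oct_triples_def, simplified]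
  oct_mult_table[of 6 1 5, unfolded oct_triples_def, simplified]
  oct_mult_table[of 5 2 7, unfolded oct_triples_def, simplified]
  oct_mult_table[of 7 4 6, unfolded oct_triples_def, simplified]
  oct_mult_unit oct_mult_square

lemmas oct_mult_neg = bilinear_lneg[OF bilinear_oct_mult] bilinear_rneg[OF bilinear_oct_mult]

lemma oct_cnj_basis:
  "oct_cnj (oct_e 0) = oct_e 0" "k \<noteq> 0 \<Longrightarrow> oct_cnj (oct_e k) = - oct_e k"
  by (auto simp: oct_cnj_def vec_eq_iff axis_def)

lemmas oct_tau_neg = linear_neg[OF linear_oct_tau]

lemma bilinear_eq_on_oct_e:
  assumes "bilinear f" "bilinear g" "\<And>i j. f (oct_e i) (oct_e j) = g (oct_e i) (oct_e j)"
  shows "f x y = g x y"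
proof -
  have "f = g"
    using assms by (intro bilinear_eq_stdbasis) (auto simp: Basis_vec_def)
  then show ?thesis by simp
qed

lemma linear_eq_on_oct_e:
  assumes "linear f" "linear g" "\<And>i. f (oct_e i) = g (oct_e i)"
  shows "f x = g x"
proof -
  have "f = g"
    using assms by (intro linear_eq_stdbasis) (auto simp: Basis_vec_def)
  then show ?thesis by simp
qed

text \<open>Both sides are bilinear, so 64 products of units decide. Since \<open>oct_tau\<close>
  permutes the units up to sign, each case is a lookup in the multiplication table.\<close>

lemma oct_tau_mult: "oct_tau (oct_mult x y) = oct_mult (oct_tau x) (oct_tau y)"
proof (rule bilinear_eq_on_oct_e[where f = "\<lambda>x y. oct_tau (oct_mult x y)"
      and g = "\<lambda>x y. oct_mult (oct_tau x) (oct_tau y)"])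
  show "bilinear (\<lambda>x y. oct_tau (oct_mult x y))" "bilinear (\<lambda>x y. oct_mult (oct_tau x) (oct_tau y))"
    using bilinear_oct_mult linear_oct_tau unfolding bilinear_def
    by (auto intro: linear_compose[unfolded o_def])
  have "\<forall>i j. oct_tau (oct_mult (oct_e i) (oct_e j)) = oct_mult (oct_tau (oct_e i)) (oct_tau (oct_e j))"
    unfolding forall_8 by (simp add: oct_mult_basis oct_mult_neg oct_tau_neg oct_tau_basis)
  then show "oct_tau (oct_mult (oct_e i) (oct_e j)) = oct_mult (oct_tau (oct_e i)) (oct_tau (oct_e j))" for i j
    by blast
qed

lemma oct_tau_cube: "oct_tau (oct_tau (oct_tau x)) = x"
proof (rule linear_eq_on_oct_e[where g = "\<lambda>x. x"])
  show "linear (\<lambda>x. oct_tau (oct_tau (oct_tau x)))" "linear (\<lambda>x::octonion. x)"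
    using linear_oct_tau by (auto intro: linear_compose[unfolded o_def] linear_ident)
  have "\<forall>i. oct_tau (oct_tau (oct_tau (oct_e i))) = oct_e i"
    unfolding forall_8 by (simp add: oct_tau_neg oct_tau_basis)
  then show "oct_tau (oct_tau (oct_tau (oct_e i))) = oct_e i" for i
    by blast
qed

lemma automorphism_oct_tau: "real_algebra_automorphism UNIV oct_mult oct_tau"
proof -
  \<comment> \<open>The square of \<open>oct_tau\<close> is its inverse, because its cube is the
    identity.\<close>
  have "bij oct_tau"
    by (rule bij_betw_byWitness[where f' = "\<lambda>x. oct_tau (oct_tau x)"]) (simp_all add: oct_tau_cube)
  then show ?thesis
    by (simp add: real_algebra_automorphism_def real_algebra_iso_def oct_tau_mult
        linear_add[OF linear_oct_tau] linear_scale[OF linear_oct_tau])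
qed

lemma order_oct_tau: "map_has_order oct_tau 3"
proof -
  \<comment> \<open>The orbit \<open>oct_e 1\<close>, \<open>oct_e 2\<close>,
    \<open>- oct_e 4\<close> excludes orders one and two at once.\<close>
  have "oct_tau (oct_e 1) \<noteq> oct_e 1" "oct_tau (oct_tau (oct_e 1)) \<noteq> oct_e 1"
    by (simp_all add: oct_tau_basis oct_tau_neg vec_eq_iff forall_8 axis_nth_if)
  then have "oct_tau \<noteq> id" "oct_tau \<circ> oct_tau \<noteq> id"
    by (auto simp: fun_eq_iff)
  then have "oct_tau ^^ k \<noteq> id" if "0 < k" "k < 3" for k
  proof -
    have "k = 1 \<or> k = 2" using that by auto
    then show ?thesis
      using \<open>oct_tau \<noteq> id\<close> \<open>oct_tau \<circ> oct_tau \<noteq> id\<close> by (auto simp: numeral_2_eq_2)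
  qed
  moreover have "oct_tau ^^ 3 = id"
    by (simp add: numeral_3_eq_3 fun_eq_iff oct_tau_cube)
  ultimately show ?thesis
    by (simp add: map_has_order_def)
qed

text \<open>The entries \<open>b\<close> and \<open>c\<close> vanish on the vectors fixed by
  \<open>oct_tau\<close>, spanned by \<open>e0\<close>, \<open>e3\<close>,
  \<open>e1 + e2 - e4\<close> and \<open>e5 - e6 - e7\<close>; these go to the block matrices
  commuting with diag(-1, -1, 2).\<close>

definition okubo_matrix :: "octonion \<Rightarrow> complex ^ 3 ^ 3" where
  "okubo_matrix x =
    (let a = Complex (x $ 1 + x $ 2 - x $ 4) (x $ 5 - x $ 6 - x $ 7);
         b = Complex (x $ 1 - (x $ 2 - x $ 4) / 2 + sqrt 3 / 2 * (x $ 5 + x $ 6))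
                     (x $ 7 + (x $ 5 - x $ 6) / 2 - sqrt 3 / 2 * (x $ 2 + x $ 4));
         c = Complex (- x $ 1 + (x $ 2 - x $ 4) / 2 + sqrt 3 / 2 * (x $ 5 + x $ 6))
                     (x $ 7 + (x $ 5 - x $ 6) / 2 + sqrt 3 / 2 * (x $ 2 + x $ 4))
     in vector [vector [of_real (sqrt 3 * x $ 3 - x $ 0), a, b],
                vector [cnj a, of_real (- sqrt 3 * x $ 3 - x $ 0), c],
                vector [cnj b, cnj c, of_real (2 * x $ 0)]])"

lemma okubo_matrix_nth:
  "okubo_matrix x $ 1 $ 1 = Complex (sqrt 3 * x $ 3 - x $ 0) 0"
  "okubo_matrix x $ 1 $ 2 = Complex (x $ 1 + x $ 2 - x $ 4) (x $ 5 - x $ 6 - x $ 7)"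
  "okubo_matrix x $ 1 $ 3 =
     Complex (x $ 1 - (x $ 2 - x $ 4) / 2 + sqrt 3 / 2 * (x $ 5 + x $ 6))
             (x $ 7 + (x $ 5 - x $ 6) / 2 - sqrt 3 / 2 * (x $ 2 + x $ 4))"
  "okubo_matrix x $ 2 $ 2 = Complex (- sqrt 3 * x $ 3 - x $ 0) 0"
  "okubo_matrix x $ 2 $ 3 =
     Complex (- x $ 1 + (x $ 2 - x $ 4) / 2 + sqrt 3 / 2 * (x $ 5 + x $ 6))
             (x $ 7 + (x $ 5 - x $ 6) / 2 + sqrt 3 / 2 * (x $ 2 + x $ 4))"
  "okubo_matrix x $ 2 $ 1 = cnj (okubo_matrix x $ 1 $ 2)"
  "okubo_matrix x $ 3 $ 1 = cnj (okubo_matrix x $ 1 $ 3)"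
  "okubo_matrix x $ 3 $ 2 = cnj (okubo_matrix x $ 2 $ 3)"
  "okubo_matrix x $ 3 $ 3 = Complex (2 * x $ 0) 0"
  by (simp_all add: okubo_matrix_def Let_def complex_eq_iff)

lemma linear_okubo_matrix: "linear okubo_matrix"
  by (rule linearI)
    (simp_all add: vec_eq_iff forall_3 okubo_matrix_nth complex_eq_iff algebra_simps add_divide_distrib
      diff_divide_distrib)

lemma okubo_matrix_carrier: "okubo_matrix x \<in> okubo_carrier"
  by (simp add: okubo_carrier_def hermitian_matrix_def vec_eq_iff forall_3 trace_def sum_3
      okubo_matrix_nth complex_eq_iff)

text \<open>Hermitian symmetry gives the lower triangle and a real diagonal, and zero trace gives
  the last entry. Eight real numbers remain, matching the dimension.\<close>

lemma okubo_carrier_eqI: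
  assumes "A \<in> okubo_carrier" "B \<in> okubo_carrier"
    and "Re (A $ 1 $ 1) = Re (B $ 1 $ 1)" "Re (A $ 2 $ 2) = Re (B $ 2 $ 2)"
    and "A $ 1 $ 2 = B $ 1 $ 2" "A $ 1 $ 3 = B $ 1 $ 3" "A $ 2 $ 3 = B $ 2 $ 3"
  shows "A = B"
proof -
  have *: "cnj (M $ j $ i) = M $ i $ j" "Im (M $ i $ i) = 0"
      "M $ 3 $ 3 = - M $ 1 $ 1 - M $ 2 $ 2" if "M \<in> okubo_carrier" for M i j
  proof -
    show h: "cnj (M $ j $ i) = M $ i $ j" for i j
      using that by (auto simp: okubo_carrier_def hermitian_matrix_def vec_eq_iff)
    show "Im (M $ i $ i) = 0"
      using h[of i i] by (simp add: complex_eq_iff)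
    show "M $ 3 $ 3 = - M $ 1 $ 1 - M $ 2 $ 2"
      using that by (simp add: okubo_carrier_def trace_def sum_3 complex_eq_iff)
  qed
  have "A $ 1 $ 1 = B $ 1 $ 1" "A $ 2 $ 2 = B $ 2 $ 2"
    using assms *(2) by (simp_all add: complex_eq_iff)
  moreover have "A $ 2 $ 1 = B $ 2 $ 1" "A $ 3 $ 1 = B $ 3 $ 1" "A $ 3 $ 2 = B $ 3 $ 2"
    using assms *(1) by metis+
  ultimately show ?thesis
    using assms *(3) by (simp add: vec_eq_iff forall_3)
qed

text \<open>At \<open>okubo_matrix x\<close> the combinations for \<open>x1\<close> and
  \<open>x7\<close> cancel all other coordinates; then \<open>d\<close> and \<open>s\<close> are the
  difference and sum of coordinates 2 and 4, \<open>d'\<close> and \<open>s'\<close> those of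
  coordinates 5 and 6.\<close>

definition octonion_of_okubo :: "complex ^ 3 ^ 3 \<Rightarrow> octonion" where
  "octonion_of_okubo A =
    (let x1 = (Re (A $ 1 $ 2) + Re (A $ 1 $ 3) - Re (A $ 2 $ 3)) / 3;
         x7 = (Im (A $ 1 $ 3) + Im (A $ 2 $ 3) - Im (A $ 1 $ 2)) / 3;
         d = Re (A $ 1 $ 2) - x1; s = (Im (A $ 2 $ 3) - Im (A $ 1 $ 3)) / sqrt 3;
         d' = Im (A $ 1 $ 2) + x7; s' = (Re (A $ 1 $ 3) + Re (A $ 2 $ 3)) / sqrt 3
     in (- (Re (A $ 1 $ 1) + Re (A $ 2 $ 2)) / 2) *\<^sub>R oct_e 0
      + ((Re (A $ 1 $ 1) - Re (A $ 2 $ 2)) / (2 * sqrt 3)) *\<^sub>R oct_e 3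
      + x1 *\<^sub>R oct_e 1 + ((s + d) / 2) *\<^sub>R oct_e 2 + ((s - d) / 2) *\<^sub>R oct_e 4
      + x7 *\<^sub>R oct_e 7 + ((s' + d') / 2) *\<^sub>R oct_e 5 + ((s' - d') / 2) *\<^sub>R oct_e 6)"

lemma octonion_of_okubo_matrix: "octonion_of_okubo (okubo_matrix x) = x"
  unfolding vec_eq_iff forall_8
  by (simp add: octonion_of_okubo_def okubo_matrix_nth Let_def axis_nth_if field_simps)

lemma okubo_matrix_of_okubo:
  assumes "A \<in> okubo_carrier"
  shows "okubo_matrix (octonion_of_okubo A) = A"
  by (rule okubo_carrier_eqI[OF okubo_matrix_carrier assms])
    (simp_all add: octonion_of_okubo_def okubo_matrix_nth Let_def axis_nth_if complex_eq_iff field_simps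
      sqrt_3_mult)

lemma bij_okubo_matrix: "bij_betw okubo_matrix UNIV okubo_carrier"
  by (rule bij_betw_byWitness[where f' = octonion_of_okubo])
    (auto simp: octonion_of_okubo_matrix okubo_matrix_of_okubo okubo_matrix_carrier)

lemma okubo_mu_Complex: "okubo_mu = Complex (1 / 2) (sqrt 3 / 6)"
  by (simp add: okubo_mu_def complex_eq_iff)

text \<open>With \<open>okubo_mu\<close> and its conjugate as explicit \<open>Complex\<close> pairs,
  comparing entries becomes real arithmetic in \<open>sqrt 3\<close>.\<close>

lemma okubo_mult_nth:
  "okubo_mult A B $ i $ j =
     Complex (1 / 2) (sqrt 3 / 6) * (A $ i $ 1 * B $ 1 $ j + A $ i $ 2 * B $ 2 $ j + A $ i $ 3 * B $ 3 $ j)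
     + Complex (1 / 2) (- sqrt 3 / 6) * (B $ i $ 1 * A $ 1 $ j + B $ i $ 2 * A $ 2 $ j + B $ i $ 3 * A $ 3 $ j)
     - (if i = j then trace (A ** B) / 3 else 0)"
  by (simp add: okubo_mult_def cmat_scale_def matrix_matrix_mult_def sum_3 mat_def okubo_mu_Complex
      complex_cnj)

text \<open>Each Petersson product of units is again a signed unit, and both sides lie in the
  carrier, so five entries settle each of the 64 cases.\<close>

lemma okubo_matrix_mult_basis:
  "okubo_matrix (petersson_mult oct_tau (oct_e i) (oct_e j))
     = okubo_mult (okubo_matrix (oct_e i)) (okubo_matrix (oct_e j))"
proof -
  have carrier: "okubo_mult (okubo_matrix x) (okubo_matrix y) \<in> okubo_carrier" for x y
    using real_algebra_okubo okubo_matrix_carrier by (auto simp: real_algebra_on_def)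
  have "\<forall>i j. okubo_matrix (petersson_mult oct_tau (oct_e i) (oct_e j))
     = okubo_mult (okubo_matrix (oct_e i)) (okubo_matrix (oct_e j))"
    unfolding forall_8 petersson_mult_def
    by (intro conjI; rule okubo_carrier_eqI[OF okubo_matrix_carrier carrier])
      (simp_all add: oct_cnj_basis oct_tau_basis oct_tau_neg numeral_2_eq_2 oct_mult_basis oct_mult_neg
        okubo_mult_nth okubo_matrix_nth trace_def matrix_matrix_mult_def sum_3 axis_nth_if complex_eq_iff)
  then show ?thesis by blast
qed

lemma okubo_matrix_mult:
  "okubo_matrix (petersson_mult oct_tau x y) = okubo_mult (okubo_matrix x) (okubo_matrix y)"
proof (rule bilinear_eq_on_oct_e[where f = "\<lambda>x y. okubo_matrix (petersson_mult oct_tau x y)"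
      and g = "\<lambda>x y. okubo_mult (okubo_matrix x) (okubo_matrix y)"])
  show "bilinear (\<lambda>x y. okubo_matrix (petersson_mult oct_tau x y))"
    using real_algebra_petersson[OF linear_oct_tau] linear_okubo_matrix
    by (auto simp: bilinear_def real_algebra_on_def linear_iff)
  \<comment> \<open>The algebra laws for \<open>okubo_mult\<close> are available on the carrier
    only, which contains every value of \<open>okubo_matrix\<close>.\<close>
  show "bilinear (\<lambda>x y. okubo_mult (okubo_matrix x) (okubo_matrix y))"
    using real_algebra_okubo linear_okubo_matrix okubo_matrix_carrier
    by (auto simp: bilinear_def real_algebra_on_def linear_iff)
qed (rule okubo_matrix_mult_basis)

theorem mainTheorem1:
  shows "real_algebra_automorphism UNIV oct_mult oct_tau \<and> map_has_order oct_tau 3 \<and>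
    real_algebra_isomorphic UNIV (petersson_mult oct_tau) okubo_carrier okubo_mult"
proof (intro conjI automorphism_oct_tau order_oct_tau)
  have "real_algebra_iso UNIV (petersson_mult oct_tau) okubo_carrier okubo_mult okubo_matrix"
    using bij_okubo_matrix linear_okubo_matrix okubo_matrix_mult
    by (simp add: real_algebra_iso_def linear_iff)
  then show "real_algebra_isomorphic UNIV (petersson_mult oct_tau) okubo_carrier okubo_mult"
    unfolding real_algebra_isomorphic_def by blast
qed

end
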